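(* Let $E_0, E_1$ be (real or complex) normed spaces, let $\mathcal I$ with norm $\|\cdot\|_{\mathcal I}$ be a normed ideal of operators, let $A\in L(E_0,E_1)$, $W_0\in\mathcal I(E_1)$, $W_1\in L(E_1)$ and $b\in E_1$, and suppose that $b\notin R(A)+N(W_0)+N(W_1)$. If $W_0A$ is not bounded below, then the problem $$\min_{X\in L(E_0,E_1),\ x\in E_0}\ \|W_0(A-X)\|_{\mathcal I}^2+\|W_1(Xx-b)\|_{E_1}^2$$ does not have a solution, i.e. the infimum of this expression over $(X,x)\in L(E_0,E_1)\times E_0$ is not attained.
   Context: $L(E_0,E_1)$ denotes the bounded linear operators from $E_0$ to $E_1$, $L(E)=L(E,E)$, $R(\cdot)$ is the range and $N(\cdot)$ the nullspace. An operator $S$ is bounded below if there is $c>0$ with $\|Sx\|\ge c\|x\|$ for all $x$. A class $\mathcal I$ of bounded linear operators with a norm $\|\cdot\|_{\mathcal I}$ is a normed ideal if each $\mathcal I(E_0,E_1):=\mathcal I\cap L(E_0,E_1)$, with $\|\cdot\|_{\mathcal I}$, is a normed space containing all finite rank operators such that: (1) $TXS\in\mathcal I(E,E_2)$ and $\|TXS\|_{\mathcal I}\le\|T\|\,\|X\|_{\mathcal I}\,\|S\|$ for all $T\in L(E_1,E_2)$, $S\in L(E,E_0)$, $X\in\mathcal I(E_0,E_1)$; (2) for $x'\in E_0^*$ and $y\in E_1$, the rank one operator $x\mapsto x'(x)y$ has $\|\cdot\|_{\mathcal I}$-norm equal to $\|x'\|_{E_0^*}\|y\|_{E_1}$. We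 write $\mathcal I(E):=\mathcal I(E,E)$. *)

theory Defs
  imports Complex_Main "HOL-Algebra.Module" "HOL-Algebra.AbelCoset"
begin

text \<open>
  The scalar field is \<open>\<real>\<close> or \<open>\<complex>\<close>. The class below says exactly this, up to an isometric
  isomorphism of normed algebras.
\<close>

class real_or_complex = real_normed_field +
  assumes real_or_complex:
    "(\<forall>z. \<exists>a. z = a *\<^sub>R 1) \<or>
     (\<exists>i. i * i = - 1 \<and> (\<forall>z. \<exists>a b. z = a *\<^sub>R 1 + b *\<^sub>R i) \<and>
       (\<forall>a b. norm (a *\<^sub>R 1 + b *\<^sub>R i) = sqrt (a\<^sup>2 + b\<^sup>2)))"

instance real :: real_or_complex
  by standard simp

instance complex :: real_or_complex
proof
  have "\<exists>a b. z = a *\<^sub>R 1 + b *\<^sub>R \<i>" for z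
    by (rule exI[of _ "Re z"], rule exI[of _ "Im z"]) (simp add: complex_eq_iff)
  moreover have "norm (a *\<^sub>R 1 + b *\<^sub>R \<i>) = sqrt (a\<^sup>2 + b\<^sup>2)" for a b
    by (simp add: cmod_def)
  ultimately show "(\<forall>z::complex. \<exists>a. z = a *\<^sub>R 1) \<or>
     (\<exists>i::complex. i * i = - 1 \<and> (\<forall>z. \<exists>a b. z = a *\<^sub>R 1 + b *\<^sub>R i) \<and>
       (\<forall>a b. norm (a *\<^sub>R 1 + b *\<^sub>R i) = sqrt (a\<^sup>2 + b\<^sup>2)))"
    by (intro disjI2 exI[of _ \<i>]) simp
qed

text \<open>
  A normed ideal assigns a space of operators to every pair of normed spaces, so normed spaces have
  to be values that can be quantified over rather than types. They are modules in the sense of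
  HOL-Algebra, with a norm as additional component. The fields \<open>mult\<close> and \<open>one\<close>, which the record
  \<open>module\<close> inherits from \<open>ring\<close>, play no role.
\<close>

record ('k, 'a) normed_space = "('k, 'a) module" +
  nrm :: "'a \<Rightarrow> real"

text \<open>The scalars, both as a ring and as a one-dimensional normed space over itself.\<close>

definition scalars :: "('k::real_or_complex, 'k) normed_space" where
  "scalars = \<lparr>carrier = UNIV, mult = (*), one = 1, zero = 0, add = (+), smult = (*), nrm = norm\<rparr>"

locale normed_space = Module.module "scalars :: ('k::real_or_complex, 'k) normed_space" E
  for E :: "('k::real_or_complex, 'a) normed_space" (structure) +
  assumes nrm_eq_zero_iff: "x \<in> carrier E \<Longrightarrow> nrm E x = 0 \<longleftrightarrow> x = \<zero>"
    and nrm_triangle: "\<lbrakk>x \<in> carrier E; y \<in> carrier E\<rbrakk> \<Longrightarrow> nrm E (x \<oplus> y) \<le> nrm E x + nrm E y"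
    and nrm_smult: "x \<in> carrier E \<Longrightarrow> nrm E (c \<odot> x) = norm c * nrm E x"

text \<open>
  Operators are extensional functions (\<open>undefined\<close> outside the carrier), so that equality of
  functions is equality of operators.
\<close>

definition bounded_ops ::
  "('k::real_or_complex, 'a) normed_space \<Rightarrow> ('k, 'b) normed_space \<Rightarrow> ('a \<Rightarrow> 'b) set" where
  "bounded_ops E F = {T \<in> carrier E \<rightarrow>\<^sub>E carrier F.
     (\<forall>x\<in>carrier E. \<forall>y\<in>carrier E. T (x \<oplus>\<^bsub>E\<^esub> y) = T x \<oplus>\<^bsub>F\<^esub> T y) \<and>
     (\<forall>c. \<forall>x\<in>carrier E. T (c \<odot>\<^bsub>E\<^esub> x) = c \<odot>\<^bsub>F\<^esub> T x) \<and>
     (\<exists>C. \<forall>x\<in>carrier E. nrm F (T x) \<le> C * nrm E x)}"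

definition op_norm ::
  "('k::real_or_complex, 'a) normed_space \<Rightarrow> ('k, 'b) normed_space \<Rightarrow> ('a \<Rightarrow> 'b) \<Rightarrow> real" where
  "op_norm E F T = (SUP x\<in>{x \<in> carrier E. nrm E x \<le> 1}. nrm F (T x))"

text \<open>The normed space \<open>L(E, F)\<close>.\<close>

definition op_space ::
  "('k::real_or_complex, 'a) normed_space \<Rightarrow> ('k, 'b) normed_space \<Rightarrow> ('k, 'a \<Rightarrow> 'b) normed_space"
  where
  "op_space E F =
    \<lparr>carrier = bounded_ops E F, mult = undefined, one = undefined,
     zero = (\<lambda>x\<in>carrier E. \<zero>\<^bsub>F\<^esub>),
     add = (\<lambda>S T. \<lambda>x\<in>carrier E. S x \<oplus>\<^bsub>F\<^esub> T x),
     smult = (\<lambda>c T. \<lambda>x\<in>carrier E. c \<odot>\<^bsub>F\<^esub> T x),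
     nrm = op_norm E F\<rparr>"

definition bounded_below ::
  "('k::real_or_complex, 'a) normed_space \<Rightarrow> ('k, 'b) normed_space \<Rightarrow> ('a \<Rightarrow> 'b) \<Rightarrow> bool" where
  "bounded_below E F S \<longleftrightarrow> (\<exists>c>0. \<forall>x\<in>carrier E. nrm F (S x) \<ge> c * nrm E x)"

definition finite_rank ::
  "('k::real_or_complex, 'a) normed_space \<Rightarrow> ('k, 'b) normed_space \<Rightarrow> ('a \<Rightarrow> 'b) \<Rightarrow> bool" where
  "finite_rank E F S \<longleftrightarrow> S \<in> bounded_ops E F \<and>
     (\<exists>B. finite B \<and> B \<subseteq> carrier F \<and>
       (\<forall>x\<in>carrier E. \<exists>c. S x = (\<Oplus>\<^bsub>F\<^esub>y\<in>B. c y \<odot>\<^bsub>F\<^esub> y)))"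

text \<open>
  \<open>\<I> E F\<close> is the set of operators from \<open>E\<close> to \<open>F\<close> that belong to the ideal, and \<open>N E F\<close> is the
  norm of the ideal on it. The spaces range over all normed spaces whose carrier is a subset of
  the type \<open>'u\<close>. This type is arbitrary and plays the role of a universe: an ideal on all normed
  spaces restricts to one on \<open>'u\<close>, and any two given normed spaces fit into a common \<open>'u\<close>.
\<close>

locale normed_ideal =
  fixes \<I> :: "('k::real_or_complex, 'u) normed_space \<Rightarrow> ('k, 'u) normed_space \<Rightarrow> ('u \<Rightarrow> 'u) set"
    and N :: "('k, 'u) normed_space \<Rightarrow> ('k, 'u) normed_space \<Rightarrow> ('u \<Rightarrow> 'u) \<Rightarrow> real"
  assumes ideal_subset: "\<lbrakk>normed_space E\<^sub>0; normed_space E\<^sub>1\<rbrakk> \<Longrightarrow> \<I> E\<^sub>0 E\<^sub>1 \<subseteq> bounded_ops E\<^sub>0 E\<^sub>1"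
    and ideal_normed_space: "\<lbrakk>normed_space E\<^sub>0; normed_space E\<^sub>1\<rbrakk> \<Longrightarrow>
      normed_space ((op_space E\<^sub>0 E\<^sub>1)\<lparr>carrier := \<I> E\<^sub>0 E\<^sub>1, nrm := N E\<^sub>0 E\<^sub>1\<rparr>)"
    and ideal_finite_rank: "\<lbrakk>normed_space E\<^sub>0; normed_space E\<^sub>1; finite_rank E\<^sub>0 E\<^sub>1 S\<rbrakk> \<Longrightarrow>
      S \<in> \<I> E\<^sub>0 E\<^sub>1"
    and ideal_compose: "\<lbrakk>normed_space E; normed_space E\<^sub>0; normed_space E\<^sub>1; normed_space E\<^sub>2;
      T \<in> bounded_ops E\<^sub>1 E\<^sub>2; X \<in> \<I> E\<^sub>0 E\<^sub>1; S \<in> bounded_ops E E\<^sub>0\<rbrakk> \<Longrightarrow>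
      compose (carrier E) T (compose (carrier E) X S) \<in> \<I> E E\<^sub>2"
    and ideal_norm_compose: "\<lbrakk>normed_space E; normed_space E\<^sub>0; normed_space E\<^sub>1; normed_space E\<^sub>2;
      T \<in> bounded_ops E\<^sub>1 E\<^sub>2; X \<in> \<I> E\<^sub>0 E\<^sub>1; S \<in> bounded_ops E E\<^sub>0\<rbrakk> \<Longrightarrow>
      N E E\<^sub>2 (compose (carrier E) T (compose (carrier E) X S))
        \<le> op_norm E\<^sub>1 E\<^sub>2 T * N E\<^sub>0 E\<^sub>1 X * op_norm E E\<^sub>0 S"
    and ideal_norm_rank_one: "\<lbrakk>normed_space E\<^sub>0; normed_space E\<^sub>1;
      f \<in> bounded_ops E\<^sub>0 scalars; y \<in> carrier E\<^sub>1\<rbrakk> \<Longrightarrow>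
      N E\<^sub>0 E\<^sub>1 (\<lambda>x\<in>carrier E\<^sub>0. f x \<odot>\<^bsub>E\<^sub>1\<^esub> y) = op_norm E\<^sub>0 scalars f * nrm E\<^sub>1 y"

end

theory Submission
  imports Defs
begin

text \<open>
  The infimum is 0, and the value 0 is impossible.

  If \<open>(X, x)\<close> had the value 0, then \<open>W\<^sub>0 (A - X) = 0\<close> and \<open>W\<^sub>1 (X x - b) = 0\<close>, so that
  \<open>b = A x + (X x - A x) + (b - X x)\<close> would lie in \<open>R(A) + N(W\<^sub>0) + N(W\<^sub>1)\<close>
  (\<open>mem_range_plus_kernels\<close>).

  To come close to 0, one solves \<open>X x = b\<close> exactly and changes \<open>A\<close> only by the rank one operator
  \<open>D z = f z (A x - b)\<close>, where \<open>f x = 1\<close> and \<open>\<parallel>f\<parallel> \<le> 1 / \<parallel>x\<parallel>\<close>. Then \<open>W\<^sub>0 D\<close> is again of rank one and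
  its ideal norm is at most \<open>\<parallel>W\<^sub>0 A x\<parallel> / \<parallel>x\<parallel> + \<parallel>W\<^sub>0 b\<parallel> / \<parallel>x\<parallel>\<close>. Since \<open>W\<^sub>0 A\<close> is not bounded below,
  some direction of \<open>x\<close> makes the first term small. It does not depend on the length of \<open>x\<close>, and a
  long \<open>x\<close> makes the second term small (\<open>exact_solution_small_perturbation\<close>).

  The functional \<open>f\<close> comes from the theorem of Hahn and Banach. Zorn's lemma is applied here to
  sublinear functionals rather than to extensions from subspaces: a minimal sublinear functional is
  linear (\<open>exists_additive_below\<close>), and starting from a suitable sublinear functional below the norm
  forces the value \<open>\<parallel>x\<parallel>\<close> at \<open>x\<close>. Complex scalars are reduced to real ones by recovering a functional
  from its real part (\<open>exists_norming_functional\<close>).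
\<close>

section \<open>Vector space arithmetic on the carrier\<close>

lemma scalars_simps [simp]:
  "carrier scalars = UNIV" "mult scalars = (*)" "one scalars = 1" "zero scalars = 0"
  "add scalars = (+)" "smult scalars = (*)" "nrm scalars = norm"
  by (simp_all add: scalars_def)

context normed_space
begin

lemma smult_plus_left: "x \<in> carrier E \<Longrightarrow> (c + d) \<odot> x = c \<odot> x \<oplus> d \<odot> x"
  using smult_l_distr[of c d x] by simp

lemma smult_plus_right:
  "x \<in> carrier E \<Longrightarrow> y \<in> carrier E \<Longrightarrow> c \<odot> (x \<oplus> y) = c \<odot> x \<oplus> c \<odot> y"
  using smult_r_distr[of c x y] by simp

lemma smult_smult: "x \<in> carrier E \<Longrightarrow> c \<odot> (d \<odot> x) = (c * d) \<odot> x"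
  using smult_assoc1[of c d x] by simp

lemma smult_1 [simp]: "x \<in> carrier E \<Longrightarrow> 1 \<odot> x = x"
  using smult_one[of x] by simp

lemma smult_0 [simp]: "x \<in> carrier E \<Longrightarrow> 0 \<odot> x = \<zero>"
  using smult_l_null[of x] by simp

lemma smult_uminus:
  assumes "x \<in> carrier E" shows "(- c) \<odot> x = \<ominus> (c \<odot> x)"
proof -
  have "(- c) \<odot> x \<oplus> c \<odot> x = \<zero>"
    using smult_plus_left[OF assms, of "- c" c] assms by simp
  then show ?thesis
    using assms by (intro minus_equality[symmetric]) auto
qed

lemma smult_minus_one: "x \<in> carrier E \<Longrightarrow> (- 1) \<odot> x = \<ominus> x"
  using smult_uminus[of x 1] by simp

lemma nrm_zero [simp]: "nrm E \<zero> = 0"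
  using nrm_eq_zero_iff by simp

lemma nrm_uminus: "x \<in> carrier E \<Longrightarrow> nrm E (\<ominus> x) = nrm E x"
  using nrm_smult[of x "- 1"] by (simp add: smult_minus_one)

lemma nrm_nonneg:
  assumes "x \<in> carrier E" shows "0 \<le> nrm E x"
  using nrm_triangle[of x "\<ominus> x"] assms by (simp add: nrm_uminus r_neg)

lemma nrm_minus_le:
  "x \<in> carrier E \<Longrightarrow> y \<in> carrier E \<Longrightarrow> nrm E (x \<ominus> y) \<le> nrm E x + nrm E y"
  using nrm_triangle[of x "\<ominus> y"] by (simp add: nrm_uminus a_minus_def)

lemma minus_eq_zero_iff:
  assumes "x \<in> carrier E" "y \<in> carrier E"
  shows "x \<ominus> y = \<zero> \<longleftrightarrow> x = y"
  using assms minus_equality[of x "\<ominus> y"] by (auto simp: a_minus_def r_neg)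

section \<open>Minimal sublinear functionals are linear\<close>

definition sublinear :: "('a \<Rightarrow> real) \<Rightarrow> bool" where
  "sublinear q \<longleftrightarrow>
     (\<forall>x\<in>carrier E. \<forall>y\<in>carrier E. q (x \<oplus> y) \<le> q x + q y) \<and>
     (\<forall>t\<ge>0. \<forall>x\<in>carrier E. q (of_real t \<odot> x) = t * q x)"

lemma sublinear_add:
  "sublinear q \<Longrightarrow> x \<in> carrier E \<Longrightarrow> y \<in> carrier E \<Longrightarrow> q (x \<oplus> y) \<le> q x + q y"
  by (simp add: sublinear_def)

lemma sublinear_scale:
  "sublinear q \<Longrightarrow> x \<in> carrier E \<Longrightarrow> 0 \<le> t \<Longrightarrow> q (of_real t \<odot> x) = t * q x"
  by (simp add: sublinear_def)

lemma sublinear_zero: "sublinear q \<Longrightarrow> q \<zero> = 0"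
  using sublinear_scale[of q \<zero> 0] by simp

lemma sublinear_ge:
  assumes "sublinear q" "x \<in> carrier E" shows "- q (\<ominus> x) \<le> q x"
  using sublinear_add[OF assms(1), of x "\<ominus> x"] assms sublinear_zero[OF assms(1)]
  by (simp add: r_neg)

lemma sublinear_nrm: "sublinear (nrm E)"
  by (simp add: sublinear_def nrm_triangle nrm_smult)

text \<open>
  The largest sublinear minorant of \<open>q\<close> that has the value \<open>- q y\<close> at \<open>\<ominus> y\<close>, hence is linear along
  the line through \<open>y\<close>. It serves twice: it shows that a minimal sublinear functional is
  additive, and it prepares the norm so that every linear minorant is norming at a given vector.
\<close>

definition lowering :: "('a \<Rightarrow> real) \<Rightarrow> 'a \<Rightarrow> 'a \<Rightarrow> real" where
  "lowering q y x = (INF t\<in>{0..}. q (x \<oplus> of_real t \<odot> y) - t * q y)"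

lemma lowering_bdd:
  assumes "sublinear q" "y \<in> carrier E" "x \<in> carrier E"
  shows "bdd_below ((\<lambda>t. q (x \<oplus> of_real t \<odot> y) - t * q y) ` {0..})"
proof (intro bdd_belowI2)
  fix t :: real assume "t \<in> {0..}"
  then have "t * q y = q (\<ominus> x \<oplus> (x \<oplus> of_real t \<odot> y))"
    using assms by (simp add: sublinear_scale r_neg2 r_neg1)
  also have "\<dots> \<le> q (\<ominus> x) + q (x \<oplus> of_real t \<odot> y)"
    using assms by (intro sublinear_add) auto
  finally show "- q (\<ominus> x) \<le> q (x \<oplus> of_real t \<odot> y) - t * q y"
    by simp
qed

lemma lowering_le_at:
  assumes "sublinear q" "y \<in> carrier E" "x \<in> carrier E" "0 \<le> t"
  shows "lowering q y x \<le> q (x \<oplus> of_real t \<odot> y) - t * q y"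
  unfolding lowering_def using assms by (intro cINF_lower lowering_bdd) auto

lemma lowering_le:
  assumes "sublinear q" "y \<in> carrier E" "x \<in> carrier E"
  shows "lowering q y x \<le> q x"
  using lowering_le_at[OF assms, of 0] assms by simp

lemma lowering_le_step:
  assumes "sublinear q" "y \<in> carrier E" "x \<in> carrier E"
  shows "lowering q y x \<le> q (x \<oplus> y) - q y"
  using lowering_le_at[OF assms, of 1] assms by simp

lemma sublinear_lowering:
  assumes q: "sublinear q" and y: "y \<in> carrier E"
  shows "sublinear (lowering q y)"
  unfolding sublinear_def
proof (intro conjI ballI allI impI)
  fix u v assume u: "u \<in> carrier E" and v: "v \<in> carrier E"
  have sum: "lowering q y (u \<oplus> v) \<le>
      (q (u \<oplus> of_real s \<odot> y) - s * q y) + (q (v \<oplus> of_real t \<odot> y) - t * q y)"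
    if "0 \<le> s" "0 \<le> t" for s t
  proof -
    have "lowering q y (u \<oplus> v) \<le> q ((u \<oplus> v) \<oplus> of_real (s + t) \<odot> y) - (s + t) * q y"
      using q y u v that by (intro lowering_le_at) auto
    also have "(u \<oplus> v) \<oplus> of_real (s + t) \<odot> y = (u \<oplus> of_real s \<odot> y) \<oplus> (v \<oplus> of_real t \<odot> y)"
      using y u v by (simp add: smult_plus_left a_ac)
    also have "q \<dots> \<le> q (u \<oplus> of_real s \<odot> y) + q (v \<oplus> of_real t \<odot> y)"
      using q y u v by (intro sublinear_add) auto
    finally show ?thesis by (simp add: algebra_simps)
  qed
  have "lowering q y (u \<oplus> v) - (q (v \<oplus> of_real t \<odot> y) - t * q y) \<le> lowering q y u" if "0 \<le> t" for t
    unfolding lowering_def[of q y u] using sum[OF _ that]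
    by (intro cINF_greatest) (auto simp: algebra_simps)
  then have "lowering q y (u \<oplus> v) - lowering q y u \<le> lowering q y v"
    unfolding lowering_def[of q y v] by (intro cINF_greatest) (auto simp: algebra_simps)
  then show "lowering q y (u \<oplus> v) \<le> lowering q y u + lowering q y v"
    by simp
next
  fix t :: real and x assume t: "0 \<le> t" and x: "x \<in> carrier E"
  \<comment> \<open>One inequality suffices, because it can be applied to the inverse factor.\<close>
  have le: "lowering q y (of_real c \<odot> z) \<le> c * lowering q y z" if c: "0 < c" and z: "z \<in> carrier E"
    for c z
  proof -
    have "lowering q y (of_real c \<odot> z) / c \<le> q (z \<oplus> of_real s \<odot> y) - s * q y" if "0 \<le> s" for s
    proof -
      have "lowering q y (of_real c \<odot> z)
          \<le> q (of_real c \<odot> z \<oplus> of_real (c * s) \<odot> y) - (c * s) * q y"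
        using q y z c that by (intro lowering_le_at) auto
      also have "of_real c \<odot> z \<oplus> of_real (c * s) \<odot> y = of_real c \<odot> (z \<oplus> of_real s \<odot> y)"
        using y z by (simp add: smult_plus_right smult_smult)
      also have "q \<dots> = c * q (z \<oplus> of_real s \<odot> y)"
        using q y z c by (intro sublinear_scale) auto
      finally show ?thesis using c by (simp add: field_simps)
    qed
    then have "lowering q y (of_real c \<odot> z) / c \<le> lowering q y z"
      unfolding lowering_def[of q y z] by (intro cINF_greatest) auto
    then show ?thesis using c by (simp add: field_simps)
  qed
  show "lowering q y (of_real t \<odot> x) = t * lowering q y x"
  proof (cases "t = 0")
    case True
    have "lowering q y \<zero> = (INF s\<in>{0::real..}. 0)"
      unfolding lowering_def using q y by (intro INF_cong) (auto simp: sublinear_scale)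
    then show ?thesis using True x by simp
  next
    case False
    then have "0 < t" using t by simp
    moreover have "of_real (1 / t) \<odot> (of_real t \<odot> x) = x"
      using x False by (simp add: smult_smult flip: of_real_mult)
    ultimately have "lowering q y x \<le> (1 / t) * lowering q y (of_real t \<odot> x)"
      using le[of "1 / t" "of_real t \<odot> x"] x by simp
    then show ?thesis
      using le[OF \<open>0 < t\<close> x] \<open>0 < t\<close> by (simp add: field_simps)
  qed
qed

text \<open>
  Zorn's lemma applies because the pointwise infimum of a chain of sublinear functionals below \<open>p\<close>
  is sublinear. It is finite, since \<open>- p (\<ominus> x)\<close> is a lower bound at \<open>x\<close> for all of them.
\<close>

lemma exists_minimal_sublinear:
  assumes p: "sublinear p"
  obtains q where "sublinear q" "\<And>x. x \<in> carrier E \<Longrightarrow> q x \<le> p x"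
    "\<And>r x. sublinear r \<Longrightarrow> (\<And>x. x \<in> carrier E \<Longrightarrow> r x \<le> q x) \<Longrightarrow> x \<in> carrier E \<Longrightarrow> r x = q x"
proof -
  \<comment> \<open>Fixing the values outside the carrier makes the pointwise order antisymmetric.\<close>
  define S where "S = {q. sublinear q \<and> (\<forall>x\<in>carrier E. q x \<le> p x) \<and> (\<forall>x. x \<notin> carrier E \<longrightarrow> q x = 0)}"
  define restr :: "('a \<Rightarrow> real) \<Rightarrow> 'a \<Rightarrow> real"
    where "restr q = (\<lambda>x. if x \<in> carrier E then q x else 0)" for q
  have restr: "restr q \<in> S" if "sublinear q" "\<And>x. x \<in> carrier E \<Longrightarrow> q x \<le> p x" for q
    using that by (auto simp: S_def restr_def sublinear_def)
  let ?P = "\<lambda>q r. \<forall>x. r x \<le> (q x :: real)"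
  have "\<exists>q\<in>S. \<forall>r\<in>S. ?P q r \<longrightarrow> r = q"
  proof (rule predicate_Zorn)
    show "partial_order_on S (relation_of ?P S)"
    proof (rule partial_order_on_relation_ofI)
      show "a = b" if "?P a b" "?P b a" for a b
        using that by (intro ext antisym) auto
    qed (auto intro: order_trans)
  next
    fix C assume C: "C \<in> Chains (relation_of ?P S)"
    then have CS: "C \<subseteq> S" and chain: "\<And>q r. q \<in> C \<Longrightarrow> r \<in> C \<Longrightarrow> ?P q r \<or> ?P r q"
      by (auto simp: Chains_def relation_of_def)
    show "\<exists>u\<in>S. \<forall>a\<in>C. ?P a u"
    proof (cases "C = {}")
      case True
      then show ?thesis using restr[OF p] by auto
    next
      case False
      define r where "r x = (INF q\<in>C. q x)" for x
      have bdd: "bdd_below ((\<lambda>q. q x) ` C)" if "x \<in> carrier E" for x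
      proof (intro bdd_belowI2)
        fix q assume "q \<in> C"
        then have "q \<in> S" using CS by auto
        then have "q (\<ominus> x) \<le> p (\<ominus> x)" "- q (\<ominus> x) \<le> q x"
          using sublinear_ge[of q x] that by (auto simp: S_def)
        then show "- p (\<ominus> x) \<le> q x" by simp
      qed
      have low: "r x \<le> q x" if "x \<in> carrier E" "q \<in> C" for x q
        unfolding r_def using that by (intro cINF_lower bdd)
      have sub: "sublinear q" if "q \<in> C" for q
        using that CS by (auto simp: S_def)
      have "sublinear r"
        unfolding sublinear_def
      proof (intro conjI ballI allI impI)
        fix x y assume x: "x \<in> carrier E" and y: "y \<in> carrier E"
        have sum: "r (x \<oplus> y) \<le> q1 x + q2 y" if q12: "q1 \<in> C" "q2 \<in> C" for q1 q2
        proof -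
          \<comment> \<open>The smaller of the two members of the chain serves for both summands.\<close>
          obtain q where "q \<in> C" "q x \<le> q1 x" "q y \<le> q2 y"
            using chain[OF q12] q12 by blast
          then show ?thesis
            using low[of "x \<oplus> y" q] sublinear_add[OF sub, of q x y] x y by simp
        qed
        have "r (x \<oplus> y) - q2 y \<le> r x" if "q2 \<in> C" for q2
          unfolding r_def[of x] using sum[OF _ that] False
          by (intro cINF_greatest) (auto simp: algebra_simps)
        then have "r (x \<oplus> y) - r x \<le> r y"
          unfolding r_def[of y] using False by (intro cINF_greatest) (auto simp: algebra_simps)
        then show "r (x \<oplus> y) \<le> r x + r y" by simp
      next
        fix t :: real and x assume t: "0 \<le> t" and x: "x \<in> carrier E"
        have "r (of_real t \<odot> x) = (INF q\<in>C. t * q x)"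
          unfolding r_def using t x sub by (intro INF_cong) (auto simp: sublinear_scale)
        also have "\<dots> = t * r x"
        proof (cases "t = 0")
          case True
          then show ?thesis using False by simp
        next
          case tpos: False
          show ?thesis
          proof (rule antisym)
            have "(INF q\<in>C. t * q x) \<le> t * q x" if "q \<in> C" for q
              using that bdd[OF x] t
              by (intro cINF_lower) (auto simp: bdd_below_def intro!: mult_left_mono)
            then have "(INF q\<in>C. t * q x) / t \<le> r x"
              unfolding r_def using False tpos t
              by (intro cINF_greatest) (auto simp: field_simps)
            then show "(INF q\<in>C. t * q x) \<le> t * r x"
              using tpos t by (simp add: field_simps)
          next
            show "t * r x \<le> (INF q\<in>C. t * q x)"
              using False t x low by (intro cINF_greatest mult_left_mono) auto
          qed
        qed
        finally show "r (of_real t \<odot> x) = t * r x" .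
      qed
      moreover have "r x \<le> p x" if "x \<in> carrier E" for x
      proof -
        obtain q where "q \<in> C" using False by auto
        then show ?thesis using low[OF that, of q] CS that by (force simp: S_def)
      qed
      ultimately have "restr r \<in> S" by (rule restr)
      moreover have "restr r x \<le> q x" if "q \<in> C" for q x
        using that low CS by (auto simp: restr_def S_def)
      ultimately show ?thesis by blast
    qed
  qed
  then obtain q where q: "q \<in> S" and min: "\<And>r. r \<in> S \<Longrightarrow> ?P q r \<Longrightarrow> r = q" by blast
  show thesis
  proof
    show "sublinear q" "\<And>x. x \<in> carrier E \<Longrightarrow> q x \<le> p x"
      using q by (auto simp: S_def)
    fix r x assume r: "sublinear r" "\<And>x. x \<in> carrier E \<Longrightarrow> r x \<le> q x" and x: "x \<in> carrier E"
    have "restr r = q"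
      using r q by (intro min restr) (force simp: S_def restr_def)+
    then show "r x = q x" using x by (auto simp: restr_def dest: fun_cong)
  qed
qed

text \<open>
  A minimal sublinear functional \<open>f\<close> coincides with each of its lowerings, and then
  \<open>lowering_le_step\<close> is superadditivity.
\<close>

lemma exists_additive_below:
  assumes p: "sublinear p"
  obtains f where "sublinear f" "\<And>x. x \<in> carrier E \<Longrightarrow> f x \<le> p x"
    "\<And>x y. x \<in> carrier E \<Longrightarrow> y \<in> carrier E \<Longrightarrow> f (x \<oplus> y) = f x + f y"
proof -
  obtain f where f: "sublinear f" "\<And>x. x \<in> carrier E \<Longrightarrow> f x \<le> p x"
    and min: "\<And>r x. sublinear r \<Longrightarrow> (\<And>x. x \<in> carrier E \<Longrightarrow> r x \<le> f x) \<Longrightarrow> x \<in> carrier E \<Longrightarrow> r x = f x"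
    using exists_minimal_sublinear[OF p] by blast
  have "f (x \<oplus> y) = f x + f y" if "x \<in> carrier E" "y \<in> carrier E" for x y
  proof -
    have "lowering f y x = f x"
      using f that by (intro min sublinear_lowering lowering_le)
    then show ?thesis
      using lowering_le_step[OF f(1) that(2,1)] sublinear_add[OF f(1) that] by simp
  qed
  then show thesis using f that by blast
qed

section \<open>Norming functionals\<close>

text \<open>
  The lowering of the norm along \<open>a\<close> is at most \<open>- \<parallel>a\<parallel>\<close> at \<open>\<ominus> a\<close>. A linear \<open>f\<close> below it therefore
  satisfies \<open>f a \<ge> \<parallel>a\<parallel>\<close>.
\<close>

lemma exists_real_norming_functional:
  assumes a: "a \<in> carrier E"
  obtains f :: "'a \<Rightarrow> real" where
    "\<And>x y. x \<in> carrier E \<Longrightarrow> y \<in> carrier E \<Longrightarrow> f (x \<oplus> y) = f x + f y"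
    "\<And>t x. x \<in> carrier E \<Longrightarrow> f (of_real t \<odot> x) = t * f x"
    "\<And>x. x \<in> carrier E \<Longrightarrow> f x \<le> nrm E x"
    "f a = nrm E a"
proof -
  obtain f where f: "sublinear f" and le: "\<And>x. x \<in> carrier E \<Longrightarrow> f x \<le> lowering (nrm E) a x"
    and add: "\<And>x y. x \<in> carrier E \<Longrightarrow> y \<in> carrier E \<Longrightarrow> f (x \<oplus> y) = f x + f y"
    by (rule exists_additive_below[OF sublinear_lowering[OF sublinear_nrm a]]) (rule that)
  have neg: "f (\<ominus> x) = - f x" if "x \<in> carrier E" for x
    using add[of x "\<ominus> x"] sublinear_zero[OF f] that by (simp add: r_neg)
  have scale: "f (of_real t \<odot> x) = t * f x" if x: "x \<in> carrier E" for t x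
  proof (cases "0 \<le> t")
    case False
    have "of_real t \<odot> x = \<ominus> (of_real (- t) \<odot> x)"
      using smult_uminus[OF x, of "of_real (- t)"] by simp
    then show ?thesis
      using False x sublinear_scale[OF f x, of "- t"] by (simp add: neg)
  qed (simp add: sublinear_scale[OF f x])
  have nrm: "f x \<le> nrm E x" if "x \<in> carrier E" for x
    using le[OF that] lowering_le[OF sublinear_nrm a that] by simp
  have "f (\<ominus> a) \<le> - nrm E a"
    using le[of "\<ominus> a"] lowering_le_step[OF sublinear_nrm a, of "\<ominus> a"] a by (simp add: l_neg)
  then have "f a = nrm E a"
    using nrm[OF a] neg[OF a] by simp
  with add scale nrm show thesis by (rule that)
qed

end

lemma real_or_complex_cases:
  obtains (real) "\<And>z :: 'k::real_or_complex. \<exists>a. z = of_real a"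
  | (complex) i :: "'k::real_or_complex" where "i * i = - 1"
      "\<And>z. \<exists>a b. z = of_real a + of_real b * i"
      "\<And>a b. norm (of_real a + of_real b * i) = sqrt (a\<^sup>2 + b\<^sup>2)"
  using real_or_complex[where 'a = 'k] that
  by (auto simp: of_real_def)

context normed_space
begin

text \<open>
  A functional that is linear over the reals and bounded by the norm is the real part of a
  functional that is linear over the scalars. The bound carries over because a unimodular factor
  turns the value at a given vector into its modulus, so that only the real part counts.
\<close>

lemma exists_norming_functional:
  fixes a :: 'a
  assumes a: "a \<in> carrier E"
  obtains F :: "'a \<Rightarrow> 'k" where
    "\<And>x y. x \<in> carrier E \<Longrightarrow> y \<in> carrier E \<Longrightarrow> F (x \<oplus> y) = F x + F y"
    "\<And>c x. x \<in> carrier E \<Longrightarrow> F (c \<odot> x) = c * F x"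
    "\<And>x. x \<in> carrier E \<Longrightarrow> norm (F x) \<le> nrm E x"
    "nrm E a \<le> norm (F a)"
proof -
  obtain f :: "'a \<Rightarrow> real" where
    add: "\<And>x y. x \<in> carrier E \<Longrightarrow> y \<in> carrier E \<Longrightarrow> f (x \<oplus> y) = f x + f y"
    and scale: "\<And>t x. x \<in> carrier E \<Longrightarrow> f (of_real t \<odot> x) = t * f x"
    and le: "\<And>x. x \<in> carrier E \<Longrightarrow> f x \<le> nrm E x"
    and fa: "f a = nrm E a"
    by (rule exists_real_norming_functional[OF a]) (rule that)
  have neg: "f (\<ominus> x) = - f x" if "x \<in> carrier E" for x
    using scale[OF that, of "- 1"] that by (simp add: smult_minus_one)
  show thesis
  proof (cases rule: real_or_complex_cases[where 'k = 'k])
    case real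
    show thesis
    proof (rule that[of "\<lambda>x. of_real (f x)"])
      show "of_real (f (c \<odot> x)) = c * of_real (f x)" if "x \<in> carrier E" for c x
        using real[of c] scale[OF that] by auto
      show "norm (of_real (f x) :: 'k) \<le> nrm E x" if "x \<in> carrier E" for x
        using le[OF that] le[of "\<ominus> x"] that by (simp add: neg nrm_uminus)
    qed (auto simp: add fa)
  next
    case (complex i)
    \<comment> \<open>The unique scalar-linear functional with real part \<open>f\<close>.\<close>
    define F where "F x = of_real (f x) + of_real (- f (i \<odot> x)) * i" for x
    have Fadd: "F (x \<oplus> y) = F x + F y" if "x \<in> carrier E" "y \<in> carrier E" for x y
      using that by (simp add: F_def smult_plus_right add algebra_simps)
    have Freal: "F (of_real t \<odot> x) = of_real t * F x" if "x \<in> carrier E" for t x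
    proof -
      have "i \<odot> (of_real t \<odot> x) = of_real t \<odot> (i \<odot> x)"
        using that by (simp add: smult_smult mult.commute)
      then show ?thesis using that by (simp add: F_def scale algebra_simps)
    qed
    have Fi: "F (i \<odot> x) = i * F x" if "x \<in> carrier E" for x
    proof -
      have "i \<odot> (i \<odot> x) = \<ominus> x"
        using that complex(1) by (simp add: smult_smult smult_minus_one)
      moreover have "i * (of_real r * i) = - of_real r" for r
        using complex(1) by (metis mult.left_commute mult_minus1_right)
      ultimately show ?thesis using that by (simp add: F_def neg algebra_simps)
    qed
    have Fscale: "F (c \<odot> x) = c * F x" if x: "x \<in> carrier E" for c x
    proof -
      obtain s t where c: "c = of_real s + of_real t * i" using complex(2) by blast
      have "c \<odot> x = of_real s \<odot> x \<oplus> of_real t \<odot> (i \<odot> x)"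
        using x by (simp add: c smult_plus_left smult_smult)
      then show ?thesis using x by (simp add: Fadd Freal Fi c algebra_simps)
    qed
    have Fle: "norm (F x) \<le> nrm E x" if x: "x \<in> carrier E" for x
    proof (cases "F x = 0")
      case False
      define c where "c = of_real (norm (F x)) / F x"
      have c: "norm c = 1" using False by (simp add: c_def norm_divide)
      have "F (c \<odot> x) = of_real (norm (F x))"
        using False by (simp add: Fscale[OF x] c_def)
      \<comment> \<open>Comparing real parts: a scalar vanishes only if both of its real coordinates do.\<close>
      then have "of_real (f (c \<odot> x) - norm (F x)) + of_real (- f (i \<odot> (c \<odot> x))) * i = 0"
        by (simp add: F_def algebra_simps)
      then have "sqrt ((f (c \<odot> x) - norm (F x))\<^sup>2 + (- f (i \<odot> (c \<odot> x)))\<^sup>2) = 0"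
        unfolding complex(3)[symmetric] by simp
      then have "f (c \<odot> x) = norm (F x)"
        by (simp add: sum_power2_eq_zero_iff)
      then show ?thesis using le[of "c \<odot> x"] x c by (simp add: nrm_smult)
    qed (simp add: nrm_nonneg x)
    have "nrm E a \<le> norm (F a)"
      unfolding F_def complex(3) by (intro real_le_rsqrt) (simp add: fa)
    with Fadd Fscale Fle show thesis by (rule that)
  qed
qed


lemma exists_functional_value_one:
  assumes a: "a \<in> carrier E" and nz: "0 < nrm E a"
  obtains f where "f \<in> bounded_ops E scalars" "f a = 1" "op_norm E scalars f \<le> 1 / nrm E a"
proof -
  obtain F :: "'a \<Rightarrow> 'k" where
    add: "\<And>x y. x \<in> carrier E \<Longrightarrow> y \<in> carrier E \<Longrightarrow> F (x \<oplus> y) = F x + F y"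
    and scale: "\<And>c x. x \<in> carrier E \<Longrightarrow> F (c \<odot> x) = c * F x"
    and le: "\<And>x. x \<in> carrier E \<Longrightarrow> norm (F x) \<le> nrm E x"
    and Fa: "nrm E a \<le> norm (F a)"
    by (rule exists_norming_functional[OF a]) (rule that)
  define f where "f = (\<lambda>x\<in>carrier E. F x / F a)"
  have Fa_nz: "F a \<noteq> 0" using Fa nz by auto
  have bound: "norm (f x) \<le> (1 / nrm E a) * nrm E x" if "x \<in> carrier E" for x
  proof -
    have "norm (F x) / norm (F a) \<le> nrm E x / nrm E a"
      using le[OF that] Fa nz by (intro frac_le) (auto simp: nrm_nonneg that)
    then show ?thesis using that by (simp add: f_def norm_divide)
  qed
  show thesis
  proof
    show "f \<in> bounded_ops E scalars"
      unfolding bounded_ops_def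
    proof (intro CollectI conjI)
      show "\<exists>C. \<forall>x\<in>carrier E. nrm scalars (f x) \<le> C * nrm E x"
        using bound by (intro exI[of _ "1 / nrm E a"]) simp
    qed (auto simp: f_def add scale add_divide_distrib)
    show "f a = 1" using a Fa_nz by (simp add: f_def)
    show "op_norm E scalars f \<le> 1 / nrm E a"
      unfolding op_norm_def
    proof (intro cSUP_least)
      have "\<zero> \<in> {x \<in> carrier E. nrm E x \<le> 1}" by simp
      then show "{x \<in> carrier E. nrm E x \<le> 1} \<noteq> {}" by blast
      fix x assume x: "x \<in> {x \<in> carrier E. nrm E x \<le> 1}"
      then have "(1 / nrm E a) * nrm E x \<le> 1 / nrm E a"
        using nz by (simp add: field_simps)
      then show "nrm scalars (f x) \<le> 1 / nrm E a"
        using bound[of x] x by simp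
    qed
  qed
qed

end

section \<open>Bounded operators\<close>

lemma bounded_ops_closed: "T \<in> bounded_ops E F \<Longrightarrow> x \<in> carrier E \<Longrightarrow> T x \<in> carrier F"
  by (auto simp: bounded_ops_def)

lemma bounded_ops_add:
  "T \<in> bounded_ops E F \<Longrightarrow> x \<in> carrier E \<Longrightarrow> y \<in> carrier E \<Longrightarrow>
    T (x \<oplus>\<^bsub>E\<^esub> y) = T x \<oplus>\<^bsub>F\<^esub> T y"
  by (simp add: bounded_ops_def)

lemma bounded_ops_smult:
  "T \<in> bounded_ops E F \<Longrightarrow> x \<in> carrier E \<Longrightarrow> T (c \<odot>\<^bsub>E\<^esub> x) = c \<odot>\<^bsub>F\<^esub> T x"
  by (simp add: bounded_ops_def)

lemma bounded_ops_bound: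
  assumes "T \<in> bounded_ops E F"
  obtains C where "\<And>x. x \<in> carrier E \<Longrightarrow> nrm F (T x) \<le> C * nrm E x"
proof -
  obtain C where "\<forall>x\<in>carrier E. nrm F (T x) \<le> C * nrm E x"
    using assms by (auto simp: bounded_ops_def)
  then show thesis by (intro that[of C]) simp
qed

lemma bounded_ops_minus:
  assumes "normed_space E" "normed_space F" "T \<in> bounded_ops E F" "x \<in> carrier E" "y \<in> carrier E"
  shows "T (x \<ominus>\<^bsub>E\<^esub> y) = T x \<ominus>\<^bsub>F\<^esub> T y"
proof -
  interpret E: normed_space E by fact
  interpret F: normed_space F by fact
  have "T (\<ominus>\<^bsub>E\<^esub> y) = \<ominus>\<^bsub>F\<^esub> T y"
    using bounded_ops_smult[OF assms(3,5), of "- 1"] bounded_ops_closed[OF assms(3,5)] assms(5)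
    by (simp add: E.smult_minus_one F.smult_minus_one)
  then show ?thesis
    using assms by (simp add: a_minus_def bounded_ops_add)
qed

lemma bounded_ops_identity: "normed_space E \<Longrightarrow> (\<lambda>x\<in>carrier E. x) \<in> bounded_ops E E"
proof -
  assume "normed_space E"
  then interpret normed_space E .
  show ?thesis by (auto simp: bounded_ops_def intro: exI[of _ 1])
qed

lemma bounded_ops_rank_one:
  assumes "normed_space E" "normed_space F" "f \<in> bounded_ops E scalars" "y \<in> carrier F"
  shows "(\<lambda>x\<in>carrier E. f x \<odot>\<^bsub>F\<^esub> y) \<in> bounded_ops E F"
proof -
  interpret E: normed_space E by fact
  interpret F: normed_space F by fact
  obtain C where C: "\<And>x. x \<in> carrier E \<Longrightarrow> norm (f x) \<le> C * nrm E x"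
    using bounded_ops_bound[OF assms(3)] by auto
  have "nrm F (f x \<odot>\<^bsub>F\<^esub> y) \<le> (C * nrm F y) * nrm E x" if "x \<in> carrier E" for x
    using mult_right_mono[OF C[OF that] F.nrm_nonneg[OF assms(4)]] assms(4)
    by (simp add: F.nrm_smult mult_ac)
  then show ?thesis
    using assms(4) bounded_ops_add[OF assms(3)] bounded_ops_smult[OF assms(3)]
    by (auto simp: bounded_ops_def F.smult_plus_left F.smult_smult)
qed

lemma bounded_ops_pointwise_minus:
  assumes "normed_space E" "normed_space F"
    and S: "S \<in> bounded_ops E F" and T: "T \<in> bounded_ops E F"
  shows "(\<lambda>x\<in>carrier E. S x \<ominus>\<^bsub>F\<^esub> T x) \<in> bounded_ops E F"
proof -
  interpret E: normed_space E by fact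
  interpret F: normed_space F by fact
  note cl = bounded_ops_closed[OF S] bounded_ops_closed[OF T]
  obtain B where B: "\<And>x. x \<in> carrier E \<Longrightarrow> nrm F (S x) \<le> B * nrm E x"
    using bounded_ops_bound[OF S] by blast
  obtain C where C: "\<And>x. x \<in> carrier E \<Longrightarrow> nrm F (T x) \<le> C * nrm E x"
    using bounded_ops_bound[OF T] by blast
  have "nrm F (S x \<ominus>\<^bsub>F\<^esub> T x) \<le> (B + C) * nrm E x" if "x \<in> carrier E" for x
    using F.nrm_minus_le[of "S x" "T x"] B[OF that] C[OF that] cl that by (simp add: algebra_simps)
  then have "\<exists>K. \<forall>x\<in>carrier E. nrm F (S x \<ominus>\<^bsub>F\<^esub> T x) \<le> K * nrm E x"
    by (intro exI[of _ "B + C"]) simp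
  moreover have "(S x \<oplus>\<^bsub>F\<^esub> S y) \<ominus>\<^bsub>F\<^esub> (T x \<oplus>\<^bsub>F\<^esub> T y) = (S x \<ominus>\<^bsub>F\<^esub> T x) \<oplus>\<^bsub>F\<^esub> (S y \<ominus>\<^bsub>F\<^esub> T y)"
    if "x \<in> carrier E" "y \<in> carrier E" for x y
    using cl that by (simp add: a_minus_def F.minus_add F.a_ac)
  moreover have "(c \<odot>\<^bsub>F\<^esub> S x) \<ominus>\<^bsub>F\<^esub> (c \<odot>\<^bsub>F\<^esub> T x) = c \<odot>\<^bsub>F\<^esub> (S x \<ominus>\<^bsub>F\<^esub> T x)"
    if "x \<in> carrier E" for x c
    using cl that
    by (simp add: a_minus_def F.smult_plus_right F.smult_smult flip: F.smult_minus_one)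
  ultimately show ?thesis
    using cl
    by (auto simp: bounded_ops_def bounded_ops_add[OF S] bounded_ops_add[OF T]
        bounded_ops_smult[OF S] bounded_ops_smult[OF T])
qed

text \<open>
  The difference in \<open>op_space\<close> refers to the group inverse, which is a definite description. The
  inverse is identified by exhibiting the pointwise one and checking that it is the only one.
\<close>

lemma op_space_minus:
  assumes "normed_space E" "normed_space F"
    and S: "S \<in> bounded_ops E F" and T: "T \<in> bounded_ops E F"
  shows "S \<ominus>\<^bsub>op_space E F\<^esub> T = (\<lambda>x\<in>carrier E. S x \<ominus>\<^bsub>F\<^esub> T x)"
proof -
  interpret E: normed_space E by fact
  interpret F: normed_space F by fact
  note clT = bounded_ops_closed[OF T]
  let ?O = "\<lambda>x\<in>carrier E. \<zero>\<^bsub>F\<^esub>"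
  let ?m = "\<lambda>x\<in>carrier E. ?O x \<ominus>\<^bsub>F\<^esub> T x"
  have ext: "U \<in> extensional (carrier E)" if "U \<in> bounded_ops E F" for U
    using that by (auto simp: bounded_ops_def PiE_def)
  have "?O \<in> bounded_ops E F"
    by (auto simp: bounded_ops_def E.nrm_nonneg intro: exI[of _ 0])
  then have m: "?m \<in> bounded_ops E F"
    by (intro bounded_ops_pointwise_minus assms)
  have "\<ominus>\<^bsub>op_space E F\<^esub> T = ?m"
    unfolding a_inv_def m_inv_def
  proof (rule the_equality)
    show "?m \<in> carrier (add_monoid (op_space E F)) \<and>
        T \<otimes>\<^bsub>add_monoid (op_space E F)\<^esub> ?m = \<one>\<^bsub>add_monoid (op_space E F)\<^esub> \<and>
        ?m \<otimes>\<^bsub>add_monoid (op_space E F)\<^esub> T = \<one>\<^bsub>add_monoid (op_space E F)\<^esub>"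
      using m clT
      by (auto simp: op_space_def a_minus_def F.r_neg F.l_neg intro!: restrict_ext)
  next
    fix U assume "U \<in> carrier (add_monoid (op_space E F)) \<and>
        T \<otimes>\<^bsub>add_monoid (op_space E F)\<^esub> U = \<one>\<^bsub>add_monoid (op_space E F)\<^esub> \<and>
        U \<otimes>\<^bsub>add_monoid (op_space E F)\<^esub> T = \<one>\<^bsub>add_monoid (op_space E F)\<^esub>"
    then have U: "U \<in> bounded_ops E F" and inv: "(\<lambda>x\<in>carrier E. U x \<oplus>\<^bsub>F\<^esub> T x) = ?O"
      by (auto simp: op_space_def)
    have "U x = ?m x" if x: "x \<in> carrier E" for x
    proof -
      have "U x \<oplus>\<^bsub>F\<^esub> T x = \<zero>\<^bsub>F\<^esub>"
        using fun_cong[OF inv, of x] x by simp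
      then have "U x = \<ominus>\<^bsub>F\<^esub> T x"
        using bounded_ops_closed[OF U x] clT[OF x] by (intro F.minus_equality[symmetric])
      then show ?thesis
        using x clT[OF x] by (simp add: a_minus_def)
    qed
    then show "U = ?m"
      using ext[OF U] ext[OF m] by (intro extensionalityI[of _ "carrier E"])
  qed
  then show ?thesis
    using clT by (auto simp: a_minus_def op_space_def intro!: restrict_ext)
qed

text \<open>
  The quotient \<open>\<parallel>S x\<parallel> / \<parallel>x\<parallel>\<close> is invariant under scaling, so a vector on which it is small can be
  made as long as desired.
\<close>

lemma exists_large_vector_small_image:
  assumes "normed_space E" "normed_space F" and S: "\<not> bounded_below E F S"
    and hom: "\<And>c x. x \<in> carrier E \<Longrightarrow> S x \<in> carrier F \<and> S (c \<odot>\<^bsub>E\<^esub> x) = c \<odot>\<^bsub>F\<^esub> S x"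
    and \<delta>: "0 < \<delta>"
  obtains x where "x \<in> carrier E" "0 < nrm E x" "nrm F (S x) \<le> \<delta> * nrm E x" "M \<le> \<delta> * nrm E x"
proof -
  interpret E: normed_space E by fact
  interpret F: normed_space F by fact
  obtain z where z: "z \<in> carrier E" "nrm F (S z) < \<delta> * nrm E z"
    using S \<delta> by (force simp: bounded_below_def not_le)
  have "0 \<le> nrm F (S z)"
    using F.nrm_nonneg hom[OF z(1)] by blast
  then have "0 < \<delta> * nrm E z"
    using z(2) by linarith
  then have pos: "0 < nrm E z"
    using \<delta> by (simp add: zero_less_mult_iff)
  define t where "t = max 1 (M / (\<delta> * nrm E z))"
  have t: "1 \<le> t" "M / (\<delta> * nrm E z) \<le> t" by (auto simp: t_def)
  have nrm_t: "nrm E (of_real t \<odot>\<^bsub>E\<^esub> z) = t * nrm E z"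
    using z t by (simp add: E.nrm_smult)
  show thesis
  proof (rule that[of "of_real t \<odot>\<^bsub>E\<^esub> z"])
    show "of_real t \<odot>\<^bsub>E\<^esub> z \<in> carrier E" using z by simp
    show "0 < nrm E (of_real t \<odot>\<^bsub>E\<^esub> z)" using nrm_t t pos by simp
    show "nrm F (S (of_real t \<odot>\<^bsub>E\<^esub> z)) \<le> \<delta> * nrm E (of_real t \<odot>\<^bsub>E\<^esub> z)"
      using nrm_t z t hom[OF z(1)] by (simp add: F.nrm_smult mult_left_mono mult.left_commute)
    show "M \<le> \<delta> * nrm E (of_real t \<odot>\<^bsub>E\<^esub> z)"
      using nrm_t t(2) \<delta> pos by (simp add: field_simps)
  qed
qed

section \<open>The minimization problem\<close>

context normed_ideal
begin

text \<open>
  The ideal property speaks of a product of three factors; the identity fills the free place.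
\<close>

lemma ideal_compose_left:
  assumes "normed_space E" "normed_space F" "W \<in> \<I> F F" "S \<in> bounded_ops E F"
  shows "compose (carrier E) W S \<in> \<I> E F"
proof -
  have W: "W \<in> bounded_ops F F" using ideal_subset assms by blast
  have "compose (carrier E) (\<lambda>x\<in>carrier F. x) (compose (carrier E) W S) \<in> \<I> E F"
    using assms by (intro ideal_compose[of E F F F] bounded_ops_identity)
  also have "compose (carrier E) (\<lambda>x\<in>carrier F. x) (compose (carrier E) W S)
      = compose (carrier E) W S"
    using bounded_ops_closed[OF W bounded_ops_closed[OF assms(4)]]
    by (auto simp: compose_def intro!: restrict_ext)
  finally show ?thesis .
qed

lemma ideal_norm_nonneg:
  assumes "normed_space E" "normed_space F" "T \<in> \<I> E F"
  shows "0 \<le> N E F T"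
  using normed_space.nrm_nonneg[OF ideal_normed_space[OF assms(1,2)]] assms(3) by simp

lemma ideal_norm_zero:
  assumes "normed_space E" "normed_space F" "T \<in> \<I> E F" "N E F T = 0" "x \<in> carrier E"
  shows "T x = \<zero>\<^bsub>F\<^esub>"
  using normed_space.nrm_eq_zero_iff[OF ideal_normed_space[OF assms(1,2)], of T] assms(3-5)
  by (simp add: op_space_def)

text \<open>
  Half of \<open>\<epsilon>\<close> is spent on \<open>\<parallel>W A x\<parallel> / \<parallel>x\<parallel>\<close> and half on \<open>\<parallel>W b\<parallel> / \<parallel>x\<parallel>\<close>. The ideal norm of \<open>W (A - X)\<close>
  is accessible because this operator has rank one.
\<close>

lemma exact_solution_small_perturbation:
  assumes E: "normed_space E" and F: "normed_space F"
    and A: "A \<in> bounded_ops E F" and W: "W \<in> \<I> F F" and b: "b \<in> carrier F"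
    and nb: "\<not> bounded_below E F (compose (carrier E) W A)" and \<epsilon>: "0 < \<epsilon>"
  obtains X x where "X \<in> bounded_ops E F" "x \<in> carrier E" "X x = b"
    "N E F (compose (carrier E) W (A \<ominus>\<^bsub>op_space E F\<^esub> X)) \<le> \<epsilon>"
proof -
  interpret E: normed_space E by (rule E)
  interpret F: normed_space F by (rule F)
  have W': "W \<in> bounded_ops F F" using ideal_subset F W by blast
  note clA = bounded_ops_closed[OF A] and clW = bounded_ops_closed[OF W']
  have hom: "compose (carrier E) W A x \<in> carrier F \<and>
      compose (carrier E) W A (c \<odot>\<^bsub>E\<^esub> x) = c \<odot>\<^bsub>F\<^esub> compose (carrier E) W A x"
    if "x \<in> carrier E" for c x
    using that clA clW bounded_ops_smult[OF A] bounded_ops_smult[OF W'] by (simp add: compose_def)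
  obtain x where x: "x \<in> carrier E" "0 < nrm E x"
    and small: "nrm F (compose (carrier E) W A x) \<le> \<epsilon> / 2 * nrm E x"
    and large: "nrm F (W b) \<le> \<epsilon> / 2 * nrm E x"
    using exists_large_vector_small_image[OF E F nb hom, of "\<epsilon> / 2" "nrm F (W b)"] \<epsilon> by auto
  obtain f where f: "f \<in> bounded_ops E scalars" and fx: "f x = 1"
    and f_le: "op_norm E scalars f \<le> 1 / nrm E x"
    using E.exists_functional_value_one[OF x] by blast
  define y where "y = A x \<ominus>\<^bsub>F\<^esub> b"
  have y: "y \<in> carrier F" using clA x b by (simp add: y_def)
  have "nrm F (W y) \<le> nrm F (W (A x)) + nrm F (W b)"
    using bounded_ops_minus[OF F F W' clA[OF x(1)] b] x b clA clW
    by (simp add: y_def F.nrm_minus_le)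
  also have "\<dots> \<le> \<epsilon> * nrm E x"
    using small large x by (simp add: compose_def field_simps)
  finally have Wy: "nrm F (W y) \<le> \<epsilon> * nrm E x" .
  define D where "D = (\<lambda>z\<in>carrier E. f z \<odot>\<^bsub>F\<^esub> y)"
  have D: "D \<in> bounded_ops E F"
    unfolding D_def by (intro bounded_ops_rank_one E F f y)
  note clD = bounded_ops_closed[OF D]
  define X where "X = (\<lambda>z\<in>carrier E. A z \<ominus>\<^bsub>F\<^esub> D z)"
  have X: "X \<in> bounded_ops E F"
    unfolding X_def by (intro bounded_ops_pointwise_minus E F A D)
  have cancel: "u \<ominus>\<^bsub>F\<^esub> (u \<ominus>\<^bsub>F\<^esub> v) = v" if "u \<in> carrier F" "v \<in> carrier F" for u v
    using that by (simp add: a_minus_def F.minus_add F.r_neg1 F.r_neg2)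
  have "X x = b"
    using x clA b y fx by (simp add: X_def D_def) (simp add: y_def cancel)
  have "A \<ominus>\<^bsub>op_space E F\<^esub> X = (\<lambda>z\<in>carrier E. A z \<ominus>\<^bsub>F\<^esub> X z)"
    by (rule op_space_minus[OF E F A X])
  also have "\<dots> = D"
    using clA clD by (auto simp: X_def cancel D_def intro!: restrict_ext)
  finally have "compose (carrier E) W (A \<ominus>\<^bsub>op_space E F\<^esub> X) = (\<lambda>z\<in>carrier E. f z \<odot>\<^bsub>F\<^esub> W y)"
    using y bounded_ops_smult[OF W' y] by (auto simp: compose_def D_def intro!: restrict_ext)
  then have "N E F (compose (carrier E) W (A \<ominus>\<^bsub>op_space E F\<^esub> X))
      = op_norm E scalars f * nrm F (W y)"
    using ideal_norm_rank_one[OF E F f clW[OF y]] by simp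
  also have "\<dots> \<le> 1 / nrm E x * nrm F (W y)"
    using f_le y clW by (intro mult_right_mono F.nrm_nonneg)
  also have "\<dots> \<le> 1 / nrm E x * (\<epsilon> * nrm E x)"
    using Wy x by (intro mult_left_mono) auto
  finally have "N E F (compose (carrier E) W (A \<ominus>\<^bsub>op_space E F\<^esub> X)) \<le> \<epsilon>"
    using x by simp
  then show thesis using that X x \<open>X x = b\<close> by blast
qed

end

lemma mem_range_plus_kernels:
  assumes E: "normed_space E" and F: "normed_space F"
    and A: "A \<in> bounded_ops E F" and V: "V \<in> bounded_ops F F" and W: "W \<in> bounded_ops F F"
    and b: "b \<in> carrier F" and x: "x \<in> carrier E" and u: "u \<in> carrier F"
    and V0: "V (A x \<ominus>\<^bsub>F\<^esub> u) = \<zero>\<^bsub>F\<^esub>" and W0: "W (u \<ominus>\<^bsub>F\<^esub> b) = \<zero>\<^bsub>F\<^esub>"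
  shows "b \<in> A ` carrier E <+>\<^bsub>F\<^esub> a_kernel F F V <+>\<^bsub>F\<^esub> a_kernel F F W"
proof -
  interpret F: normed_space F by (rule F)
  have Ax: "A x \<in> carrier F" by (rule bounded_ops_closed[OF A x])
  have swap: "T (v \<ominus>\<^bsub>F\<^esub> w) = \<zero>\<^bsub>F\<^esub>"
    if "T \<in> bounded_ops F F" "T (w \<ominus>\<^bsub>F\<^esub> v) = \<zero>\<^bsub>F\<^esub>" "v \<in> carrier F" "w \<in> carrier F" for T v w
    using that bounded_ops_closed[OF that(1)]
    by (simp add: bounded_ops_minus[OF F F that(1)] F.minus_eq_zero_iff)
  have ker: "a_kernel F F T = {v \<in> carrier F. T v = \<zero>\<^bsub>F\<^esub>}" for T
    by (simp add: a_kernel_def kernel_def)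
  have "u \<ominus>\<^bsub>F\<^esub> A x \<in> a_kernel F F V" "b \<ominus>\<^bsub>F\<^esub> u \<in> a_kernel F F W"
    using swap[OF V V0 u Ax] swap[OF W W0 b u] u Ax b by (auto simp: ker)
  moreover have "b = A x \<oplus>\<^bsub>F\<^esub> (u \<ominus>\<^bsub>F\<^esub> A x) \<oplus>\<^bsub>F\<^esub> (b \<ominus>\<^bsub>F\<^esub> u)"
    using u Ax b by (simp add: a_minus_def F.a_ac F.r_neg F.r_neg1 F.r_neg2)
  ultimately show ?thesis
    using x unfolding set_add_def' by blast
qed

theorem proposition3p1:
  fixes E\<^sub>0 E\<^sub>1 :: "('k::real_or_complex, 'u) normed_space"
    and \<I> :: "('k, 'u) normed_space \<Rightarrow> ('k, 'u) normed_space \<Rightarrow> ('u \<Rightarrow> 'u) set"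
    and N :: "('k, 'u) normed_space \<Rightarrow> ('k, 'u) normed_space \<Rightarrow> ('u \<Rightarrow> 'u) \<Rightarrow> real"
    and A W\<^sub>0 W\<^sub>1 :: "'u \<Rightarrow> 'u" and b :: 'u
  assumes "normed_space E\<^sub>0" and "normed_space E\<^sub>1"
    and "normed_ideal \<I> N"
    and "A \<in> bounded_ops E\<^sub>0 E\<^sub>1"
    and "W\<^sub>0 \<in> \<I> E\<^sub>1 E\<^sub>1"
    and "W\<^sub>1 \<in> bounded_ops E\<^sub>1 E\<^sub>1"
    and "b \<in> carrier E\<^sub>1"
    and "b \<notin> A ` carrier E\<^sub>0 <+>\<^bsub>E\<^sub>1\<^esub> a_kernel E\<^sub>1 E\<^sub>1 W\<^sub>0 <+>\<^bsub>E\<^sub>1\<^esub> a_kernel E\<^sub>1 E\<^sub>1 W\<^sub>1"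
    and "\<not> bounded_below E\<^sub>0 E\<^sub>1 (compose (carrier E\<^sub>0) W\<^sub>0 A)"
  shows "let J = (\<lambda>(X, x).
        (N E\<^sub>0 E\<^sub>1 (compose (carrier E\<^sub>0) W\<^sub>0 (A \<ominus>\<^bsub>op_space E\<^sub>0 E\<^sub>1\<^esub> X)))\<^sup>2
          + (nrm E\<^sub>1 (W\<^sub>1 (X x \<ominus>\<^bsub>E\<^sub>1\<^esub> b)))\<^sup>2)
    in \<not> (\<exists>p \<in> bounded_ops E\<^sub>0 E\<^sub>1 \<times> carrier E\<^sub>0.
          J p = (INF q \<in> bounded_ops E\<^sub>0 E\<^sub>1 \<times> carrier E\<^sub>0. J q))"
proof -
  interpret E\<^sub>1: normed_space E\<^sub>1 by fact
  interpret normed_ideal \<I> N by fact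
  note spaces = assms(1,2) and A = assms(4) and W\<^sub>1 = assms(6) and b = assms(7)
  have W\<^sub>0: "W\<^sub>0 \<in> bounded_ops E\<^sub>1 E\<^sub>1" using ideal_subset assms by blast
  define P where "P X = N E\<^sub>0 E\<^sub>1 (compose (carrier E\<^sub>0) W\<^sub>0 (A \<ominus>\<^bsub>op_space E\<^sub>0 E\<^sub>1\<^esub> X))" for X
  define R where "R X x = nrm E\<^sub>1 (W\<^sub>1 (X x \<ominus>\<^bsub>E\<^sub>1\<^esub> b))" for X :: "'u \<Rightarrow> 'u" and x
  define J where "J = (\<lambda>(X, x). (P X)\<^sup>2 + (R X x)\<^sup>2)"
  have diff: "A \<ominus>\<^bsub>op_space E\<^sub>0 E\<^sub>1\<^esub> X = (\<lambda>z\<in>carrier E\<^sub>0. A z \<ominus>\<^bsub>E\<^sub>1\<^esub> X z)"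
      "A \<ominus>\<^bsub>op_space E\<^sub>0 E\<^sub>1\<^esub> X \<in> bounded_ops E\<^sub>0 E\<^sub>1" if "X \<in> bounded_ops E\<^sub>0 E\<^sub>1" for X
    using op_space_minus[OF spaces A that] bounded_ops_pointwise_minus[OF spaces A that] by simp_all
  have False if X: "X \<in> bounded_ops E\<^sub>0 E\<^sub>1" and x: "x \<in> carrier E\<^sub>0"
    and inf: "J (X, x) = (INF q \<in> bounded_ops E\<^sub>0 E\<^sub>1 \<times> carrier E\<^sub>0. J q)" for X x
  proof -
    have "J (X, x) \<le> \<epsilon>" if \<epsilon>: "0 < \<epsilon>" for \<epsilon>
    proof -
      obtain Y y where Y: "Y \<in> bounded_ops E\<^sub>0 E\<^sub>1" "y \<in> carrier E\<^sub>0" "Y y = b" "P Y \<le> sqrt \<epsilon>"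
        using exact_solution_small_perturbation[OF spaces A assms(5) b assms(9), of "sqrt \<epsilon>"] \<epsilon>
        by (auto simp: P_def)
      have "0 \<le> P Y"
        unfolding P_def using spaces assms(5) diff(2)[OF Y(1)]
        by (intro ideal_norm_nonneg ideal_compose_left)
      then have "(P Y)\<^sup>2 \<le> \<epsilon>"
        using power_mono[OF Y(4), of 2] \<epsilon> by simp
      moreover have "R Y y = 0"
        using Y b bounded_ops_minus[OF spaces(2,2) W\<^sub>1 b b] bounded_ops_closed[OF W\<^sub>1 b]
        by (simp add: R_def E\<^sub>1.nrm_eq_zero_iff E\<^sub>1.minus_eq_zero_iff)
      ultimately have "J (Y, y) \<le> \<epsilon>" by (simp add: J_def)
      moreover have "J (X, x) \<le> J (Y, y)"
        unfolding inf using Y by (intro cINF_lower bdd_belowI2[of _ 0]) (auto simp: J_def)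
      ultimately show ?thesis by simp
    qed
    then have "J (X, x) \<le> 0" by (rule field_le_epsilon[of _ 0, simplified])
    then have zero: "P X = 0" "R X x = 0"
      by (auto simp: J_def sum_power2_le_zero_iff)
    note clX = bounded_ops_closed[OF X x]
    have "compose (carrier E\<^sub>0) W\<^sub>0 (A \<ominus>\<^bsub>op_space E\<^sub>0 E\<^sub>1\<^esub> X) \<in> \<I> E\<^sub>0 E\<^sub>1"
      using spaces assms(5) diff(2)[OF X] by (rule ideal_compose_left)
    then have "compose (carrier E\<^sub>0) W\<^sub>0 (A \<ominus>\<^bsub>op_space E\<^sub>0 E\<^sub>1\<^esub> X) x = \<zero>\<^bsub>E\<^sub>1\<^esub>"
      using zero(1) x unfolding P_def by (rule ideal_norm_zero[OF spaces])
    then have "W\<^sub>0 (A x \<ominus>\<^bsub>E\<^sub>1\<^esub> X x) = \<zero>\<^bsub>E\<^sub>1\<^esub>"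
      using x by (simp add: diff(1)[OF X] compose_def)
    moreover have "W\<^sub>1 (X x \<ominus>\<^bsub>E\<^sub>1\<^esub> b) = \<zero>\<^bsub>E\<^sub>1\<^esub>"
      using zero(2) clX b bounded_ops_closed[OF W\<^sub>1] by (simp add: R_def E\<^sub>1.nrm_eq_zero_iff)
    ultimately show False
      using mem_range_plus_kernels[OF spaces A W\<^sub>0 W\<^sub>1 b x clX] assms(8) by blast
  qed
  then show ?thesis
    unfolding J_def P_def R_def Let_def by auto
qed

end
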